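(* Let $\Gamma$ be a discrete group with $\mathrm{rk}_{BC}(\Gamma)>0$. Then $\Gamma$ is inner amenable.
   Context: A discrete group $\Gamma$ is inner amenable if it admits an atomless mean (i.e. a finitely additive probability measure defined on all subsets of $\Gamma$ that assigns measure zero to every singleton) which is invariant under the conjugation action of $\Gamma$ on itself. For a topological group $G$, a subgroup $H\leq G$ and $g\in G$, write $g^H=\{hgh^{-1}\mid h\in H\}$; the BC-centralizer of $H$ in $G$ is the subgroup $\mathrm{BC}_G(H)=\{g\in G\mid g^H\text{ is relatively compact in } G\}$. For $G$ a totally disconnected locally compact group, a closed subgroup $A\leq G$ is thin on $G$ if $A$ normalizes some compact open subgroup of $G$ and $\mathrm{BC}_G(A)$ is a finite index open subgroup of $G$. A locally compact group is regionally compact if every finite subset generates a relatively compact subgroup. Every locally compact group $A$ has a unique largest regionally compact normal subgroup, the regionally compact radical, denoted $\mathrm{Rad}_{\mathcal{RC}}(A)$. The thin rank $\mathrm{rk}_t(A)$ of a closed subgroup $A$ that is thin on $G$ is the supremum of the ranks of free abelian subgroups of $A/\mathrm{Rad}_{\mathcal{RC}}(A)$. The bounded conjugacy rank $\mathrm{rk}_{BC}(G)\in\{0,1,2,\dots\}\cup\{\infty\}$ of a totally disconnected locally compact group $G$ is the supremum of $\mathrm{rk}_t(A)$ as $A$ ranges over all compactly generated closed subgroups of $G$ that are thin on $G$. A discrete group is regarded as a totally disconnected locally compact group. *)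

theory Defs
  imports "HOL-Analysis.Analysis" "HOL-Algebra.Free_Abelian_Groups" "HOL-Library.Extended_Nat"
begin

section \<open>Topological groups\<close>

text \<open>A topological group is a pair of a group \<open>G\<close> and a topology \<open>T\<close> on its carrier. A subgroup
  \<open>A\<close> is treated as the group \<open>G\<lparr>carrier := A\<rparr>\<close> with the topology \<open>subtopology T A\<close>.\<close>

locale topological_group = group G for G (structure) and T :: "'a topology" +
  assumes topspace_eq_carrier: "topspace T = carrier G"
    and continuous_mult: "continuous_map (prod_topology T T) T (\<lambda>(x, y). x \<otimes> y)"
    and continuous_inv: "continuous_map T T (\<lambda>x. inv x)"

locale tdlc_group = topological_group +
  assumes Hausdorff: "Hausdorff_space T"
    and locally_compact: "locally_compact_space T"
    and totally_disconnected: "\<And>x. x \<in> topspace T \<Longrightarrow> connected_component_of_set T x = {x}"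

lemma tdlc_group_discrete_topology:
  fixes G (structure)
  assumes "group G"
  shows "tdlc_group G (discrete_topology (carrier G))"
proof -
  interpret group G by fact
  show ?thesis
  proof (unfold_locales, goal_cases)
    case 2
    then show ?case
      by (auto simp: continuous_map_def simp flip: prod_topology_discrete_topology)
  next
    case 4
    then show ?case by (simp add: Hausdorff_space_discrete_topology)
  next
    case 5
    then show ?case
      by (simp add: locally_compact_space_discrete_topology)
  next
    case (6 x)
    have "connected_component_of_set (discrete_topology (carrier G)) x \<subseteq> {x}"
    proof
      fix y assume "y \<in> connected_component_of_set (discrete_topology (carrier G)) x"
      then obtain S where "connectedin (discrete_topology (carrier G)) S" "x \<in> S" "y \<in> S"
        by (auto simp: connected_component_of_def)
      then show "y \<in> {x}"
        by (auto simp: connectedin_discrete_topology)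
    qed
    moreover have "x \<in> connected_component_of_set (discrete_topology (carrier G)) x"
      using 6 by (simp add: connected_component_of_refl)
    ultimately show ?case by blast
  qed (auto simp: continuous_map_def)
qed

definition relatively_compactin :: "'a topology \<Rightarrow> 'a set \<Rightarrow> bool" where
  "relatively_compactin T S \<longleftrightarrow> S \<subseteq> topspace T \<and> compactin T (T closure_of S)"

definition compactly_generated :: "('a, 'b) monoid_scheme \<Rightarrow> 'a topology \<Rightarrow> bool" where
  "compactly_generated G T \<longleftrightarrow> (\<exists>K. compactin T K \<and> generate G K = carrier G)"


section \<open>Thin subgroups\<close>

definition BC_centralizer :: "('a, 'b) monoid_scheme \<Rightarrow> 'a topology \<Rightarrow> 'a set \<Rightarrow> 'a set" where
  "BC_centralizer G T H =
    {g \<in> carrier G. relatively_compactin T ((\<lambda>h. h \<otimes>\<^bsub>G\<^esub> g \<otimes>\<^bsub>G\<^esub> inv\<^bsub>G\<^esub> h) ` H)}"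

definition thin_on :: "'a set \<Rightarrow> ('a, 'b) monoid_scheme \<Rightarrow> 'a topology \<Rightarrow> bool" where
  "thin_on A G T \<longleftrightarrow>
    subgroup A G \<and> closedin T A \<and>
    (\<exists>U. subgroup U G \<and> openin T U \<and> compactin T U \<and>
         (\<forall>a\<in>A. (\<lambda>u. a \<otimes>\<^bsub>G\<^esub> u \<otimes>\<^bsub>G\<^esub> inv\<^bsub>G\<^esub> a) ` U = U)) \<and>
    openin T (BC_centralizer G T A) \<and> finite (rcosets\<^bsub>G\<^esub> (BC_centralizer G T A))"


section \<open>The regionally compact radical and the thin rank\<close>

definition regionally_compact :: "('a, 'b) monoid_scheme \<Rightarrow> 'a topology \<Rightarrow> bool" where
  "regionally_compact G T \<longleftrightarrow>
    (\<forall>F. finite F \<and> F \<subseteq> carrier G \<longrightarrow> relatively_compactin T (generate G F))"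

text \<open>The radical is the largest element of the family of normal subgroups that are regionally
  compact locally compact groups. A subgroup of a (Hausdorff) locally compact group is locally
  compact in the subspace topology iff it is closed, hence the condition \<open>closedin T N\<close>.\<close>

definition Rad_RC :: "('a, 'b) monoid_scheme \<Rightarrow> 'a topology \<Rightarrow> 'a set" where
  "Rad_RC G T = (GREATEST N. N \<lhd> G \<and> closedin T N \<and>
    regionally_compact (G\<lparr>carrier := N\<rparr>) (subtopology T N))"

text \<open>The supremum of the ranks of the free abelian subgroups of \<open>Q\<close>; an infinite rank counts as
  \<open>\<infinity>\<close>. Any basis of such a subgroup lies in \<open>Q\<close>, so it suffices to let the
  index set \<open>S\<close> of a free abelian group range over sets of the same type.\<close>

definition free_abelian_rank_sup :: "('a, 'b) monoid_scheme \<Rightarrow> enat" where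
  "free_abelian_rank_sup Q =
    Sup {if finite S then enat (card S) else \<infinity> | (S :: 'a set) B.
      subgroup B Q \<and> Q\<lparr>carrier := B\<rparr> \<cong> free_Abelian_group S}"

definition thin_rank :: "('a, 'b) monoid_scheme \<Rightarrow> 'a topology \<Rightarrow> enat" where
  "thin_rank A T = free_abelian_rank_sup (A Mod Rad_RC A T)"

definition rk_BC :: "('a, 'b) monoid_scheme \<Rightarrow> 'a topology \<Rightarrow> enat" where
  "rk_BC G T = Sup {thin_rank (G\<lparr>carrier := A\<rparr>) (subtopology T A) | A.
    thin_on A G T \<and> compactly_generated (G\<lparr>carrier := A\<rparr>) (subtopology T A)}"


section \<open>Inner amenability\<close>

definition mean_on :: "'a set \<Rightarrow> ('a set \<Rightarrow> real) \<Rightarrow> bool" where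
  "mean_on X \<mu> \<longleftrightarrow> additive (Pow X) \<mu> \<and> (\<forall>S\<subseteq>X. 0 \<le> \<mu> S) \<and> \<mu> X = 1"

definition inner_amenable :: "('a, 'b) monoid_scheme \<Rightarrow> bool" where
  "inner_amenable G \<longleftrightarrow>
    (\<exists>\<mu>. mean_on (carrier G) \<mu> \<and> (\<forall>x\<in>carrier G. \<mu> {x} = 0) \<and>
      (\<forall>g\<in>carrier G. \<forall>S\<subseteq>carrier G. \<mu> ((\<lambda>x. g \<otimes>\<^bsub>G\<^esub> x \<otimes>\<^bsub>G\<^esub> inv\<^bsub>G\<^esub> g) ` S) = \<mu> S))"

end

theory Submission
  imports Defs
begin

text \<open>Positive rank forces some thin subgroup \<open>A\<close> to be infinite. Every element of
  \<open>H = BC(A)\<close> has a finite \<open>A\<close>-conjugacy class, so by pigeonhole each finite subset of \<open>H\<close> is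
  centralized by infinitely many elements of \<open>A\<close>. Dirac masses at such elements accumulate to an
  atomless \<open>H\<close>-invariant mean, and averaging its conjugates over the finitely many cosets of \<open>H\<close>
  makes it invariant under the whole group.\<close>

section \<open>Invariant means from compactness\<close>

text \<open>By Tychonoff, the \<open>[0,1]\<close>-valued set functions form a compact space, and
  each requirement on \<mu> is a closed condition. Finitely many of them involve only finitely many
  maps and finitely many excluded points, so the Dirac mass at a suitable common fixed point
  satisfies them all.\<close>

lemma atomless_invariant_mean_of_common_fixed_points:
  fixes X :: "'a set" and \<Phi> :: "('a \<Rightarrow> 'a) set"
  assumes maps: "\<And>f. f \<in> \<Phi> \<Longrightarrow> inj_on f X \<and> f ` X \<subseteq> X"
    and fixed: "\<And>F E. \<lbrakk>finite F; F \<subseteq> \<Phi>; finite E\<rbrakk> \<Longrightarrow> \<exists>x\<in>X - E. \<forall>f\<in>F. f x = x"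
  shows "\<exists>\<mu>. mean_on X \<mu> \<and> (\<forall>x\<in>X. \<mu> {x} = 0) \<and> (\<forall>f\<in>\<Phi>. \<forall>S\<subseteq>X. \<mu> (f ` S) = \<mu> S)"
proof -
  \<comment> \<open>The box \<open>K\<close> supplies both compactness and nonnegativity. The sets
    \<open>C (F, E)\<close> carry the equational conditions: additivity and total mass always,
    invariance only under \<open>F\<close>, null singletons only over \<open>E\<close>.\<close>
  define K where "K = (PiE UNIV (\<lambda>_. {0..1}) :: ('a set \<Rightarrow> real) set)"
  define C where "C = (\<lambda>(F, E). {\<mu> :: 'a set \<Rightarrow> real.
    (\<forall>S\<in>Pow X. \<forall>T\<in>Pow X. S \<inter> T = {} \<longrightarrow> \<mu> (S \<union> T) = \<mu> S + \<mu> T) \<and> \<mu> X = 1 \<and>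
    (\<forall>x\<in>E. \<mu> {x} = 0) \<and> (\<forall>f\<in>F. \<forall>S\<in>Pow X. \<mu> (f ` S) = \<mu> S)})"
  define I where "I = {F. finite F \<and> F \<subseteq> \<Phi>} \<times> {E :: 'a set. finite E}"
  have "compactin (product_topology (\<lambda>_. euclidean) UNIV) K"
    unfolding K_def by (simp add: compactin_PiE)
  then have "compact K"
    by (simp add: euclidean_product_topology)
  \<comment> \<open>Each condition equates expressions in values of \<mu> at fixed sets, and
    evaluation at a set is a continuous coordinate projection.\<close>
  moreover have "closed (C i)" for i
    unfolding C_def split_beta Ball_def
    by (intro closed_Collect_conj closed_Collect_all closed_Collect_imp open_Collect_const
        closed_Collect_eq continuous_intros continuous_on_product_coordinates)
  moreover have "K \<inter> (\<Inter>i\<in>J. C i) \<noteq> {}" if J: "finite J" "J \<subseteq> I" for J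
  proof -
    obtain x where x: "x \<in> X" "x \<notin> \<Union>(snd ` J)" "\<And>f. f \<in> \<Union>(fst ` J) \<Longrightarrow> f x = x"
      using fixed[of "\<Union>(fst ` J)" "\<Union>(snd ` J)"] J by (fastforce simp: I_def)
    \<comment> \<open>Invariance of the Dirac mass at \<open>x\<close>: since
      \<open>f x = x\<close>, injectivity of \<open>f\<close> on \<open>X\<close> rules out that a
      point of \<open>S\<close> other than \<open>x\<close> is sent to \<open>x\<close>.\<close>
    have fS: "x \<in> f ` S \<longleftrightarrow> x \<in> S" if "f \<in> \<Union>(fst ` J)" "S \<subseteq> X" for f S
    proof -
      have "f \<in> \<Phi>"
        using that J by (fastforce simp: I_def)
      then have "f x \<in> f ` S \<longleftrightarrow> x \<in> S"
        using maps[of f] that x(1) by (auto dest: inj_onD)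
      then show ?thesis
        using x(3)[OF that(1)] by simp
    qed
    have "(\<lambda>S. indicator S x) \<in> K"
      by (auto simp: K_def indicator_def)
    moreover have "(\<lambda>S. indicator S x) \<in> C (F, E)" if "(F, E) \<in> J" for F E
    proof -
      have FE: "F \<subseteq> \<Union>(fst ` J)" "E \<subseteq> \<Union>(snd ` J)"
        using that by force+
      have "x \<noteq> y" if "y \<in> E" for y
        using FE(2) x(2) that by blast
      moreover have "x \<in> f ` S \<longleftrightarrow> x \<in> S" if "f \<in> F" "S \<in> Pow X" for f S
        using FE(1) that by (intro fS) auto
      ultimately show ?thesis
        using x(1) by (simp add: C_def indicator_def disjoint_iff)
    qed
    ultimately have "(\<lambda>S. indicator S x) \<in> K \<inter> (\<Inter>i\<in>J. C i)"
      by (intro IntI INT_I) (simp_all add: split_paired_all)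
    then show ?thesis
      by (rule ex_in_conv[THEN iffD1, OF exI])
  qed
  ultimately have "K \<inter> (\<Inter>i\<in>I. C i) \<noteq> {}"
    by (rule compact_imp_fip_image)
  then obtain \<mu> where \<mu>: "\<mu> \<in> K" "\<And>i. i \<in> I \<Longrightarrow> \<mu> \<in> C i"
    by blast
  \<comment> \<open>Each property is read off from the smallest index that imposes it:
    \<open>({}, {})\<close>, then \<open>({}, {x})\<close>, then \<open>({f}, {})\<close>.\<close>
  have "mean_on X \<mu>"
    using \<mu>(1) \<mu>(2)[of "({}, {})"] by (auto simp: mean_on_def additive_def K_def C_def I_def)
  moreover have "\<mu> {x} = 0" for x
    using \<mu>(2)[of "({}, {x})"] by (auto simp: C_def I_def)
  moreover have "\<mu> (f ` S) = \<mu> S" if "f \<in> \<Phi>" "S \<subseteq> X" for f S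
    using \<mu>(2)[of "({f}, {})"] that by (auto simp: C_def I_def)
  ultimately show ?thesis
    by blast
qed

section \<open>Conjugation and finite conjugacy classes\<close>

context group
begin

definition conj :: "'a \<Rightarrow> 'a \<Rightarrow> 'a" where
  "conj g x = g \<otimes> x \<otimes> inv g"

lemma conj_closed [simp]: "\<lbrakk>g \<in> carrier G; x \<in> carrier G\<rbrakk> \<Longrightarrow> conj g x \<in> carrier G"
  by (simp add: conj_def)

lemma conj_comp:
  "\<lbrakk>g \<in> carrier G; h \<in> carrier G; x \<in> carrier G\<rbrakk> \<Longrightarrow> conj g (conj h x) = conj (g \<otimes> h) x"
  by (simp add: conj_def m_assoc inv_mult_group)

lemma conj_distrib:
  "\<lbrakk>g \<in> carrier G; x \<in> carrier G; y \<in> carrier G\<rbrakk> \<Longrightarrow> conj g (x \<otimes> y) = conj g x \<otimes> conj g y"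
  by (simp add: conj_def m_assoc inv_solve_left)

lemma conj_inv:
  "\<lbrakk>g \<in> carrier G; x \<in> carrier G\<rbrakk> \<Longrightarrow> conj g (inv x) = inv (conj g x)"
  by (simp add: conj_def m_assoc inv_mult_group)

lemma conj_one [simp]: "g \<in> carrier G \<Longrightarrow> conj g \<one> = \<one>"
  by (simp add: conj_def)

lemma inj_on_conj: "g \<in> carrier G \<Longrightarrow> inj_on (conj g) (carrier G)"
  by (rule inj_onI) (simp add: conj_def)

text \<open>Commutation is symmetric, so this lets the conjugating element and the fixed element
  exchange roles.\<close>

lemma conj_eq_iff_commute:
  "\<lbrakk>g \<in> carrier G; x \<in> carrier G\<rbrakk> \<Longrightarrow> conj g x = x \<longleftrightarrow> g \<otimes> x = x \<otimes> g"
  by (simp add: conj_def inv_solve_right')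

lemma image_conj_comp:
  "\<lbrakk>g \<in> carrier G; h \<in> carrier G; S \<subseteq> carrier G\<rbrakk> \<Longrightarrow> conj g ` conj h ` S = conj (g \<otimes> h) ` S"
  by (force simp: image_image conj_comp subset_eq intro!: image_cong)

text \<open>In a discrete space every set is its own closure and the compact sets are the finite
  ones.\<close>

lemma BC_centralizer_discrete:
  assumes "A \<subseteq> carrier G"
  shows "BC_centralizer G (discrete_topology (carrier G)) A =
    {g \<in> carrier G. finite ((\<lambda>a. conj a g) ` A)}"
proof -
  have "(\<lambda>a. conj a g) ` A \<subseteq> carrier G" if "g \<in> carrier G" for g
    using assms that by auto
  then show ?thesis
    by (auto simp: BC_centralizer_def relatively_compactin_def discrete_topology_closure_of
        compactin_discrete_topology conj_def Int_absorb1)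
qed

text \<open>Conjugation is multiplicative: the class of a product lies in the product of the two
  classes, and the class of an inverse consists of the inverses.\<close>

lemma subgroup_BC_centralizer_discrete:
  assumes "A \<subseteq> carrier G"
  shows "subgroup (BC_centralizer G (discrete_topology (carrier G)) A) G"
  unfolding BC_centralizer_discrete[OF assms]
proof (rule subgroupI, goal_cases)
  case 2
  have "(\<lambda>a. conj a \<one>) ` A \<subseteq> {\<one>}"
    using assms by auto
  then have "finite ((\<lambda>a. conj a \<one>) ` A)"
    by (rule finite_subset) simp
  then show ?case
    by blast
next
  case (3 x)
  then have "(\<lambda>a. conj a (inv x)) ` A = (\<lambda>y. inv y) ` (\<lambda>a. conj a x) ` A"
    using assms by (force simp: image_image conj_inv subset_eq intro!: image_cong)
  with 3 show ?case
    by simp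
next
  case (4 x y)
  then have "(\<lambda>a. conj a (x \<otimes> y)) ` A \<subseteq>
      (\<lambda>(u, v). u \<otimes> v) ` ((\<lambda>a. conj a x) ` A \<times> (\<lambda>a. conj a y) ` A)"
    using assms by (force simp: conj_distrib subset_eq)
  moreover have "finite \<dots>"
    using 4 by simp
  ultimately show ?case
    using 4 by (auto dest: finite_subset)
qed auto

text \<open>The action of \<open>a\<close> on \<open>F\<close> takes only finitely many forms, so
  infinitely many elements of \<open>A\<close> act on \<open>F\<close> exactly as some fixed
  \<open>b\<close> does. Left translation by \<open>inv b\<close> turns them into elements that fix
  \<open>F\<close> pointwise.\<close>

lemma infinite_centralizer_of_finite_conjugacy:
  assumes A: "subgroup A G" "infinite A"
    and F: "finite F" "F \<subseteq> carrier G" "\<And>x. x \<in> F \<Longrightarrow> finite ((\<lambda>a. conj a x) ` A)"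
  shows "infinite {a \<in> A. \<forall>x\<in>F. conj a x = x}"
proof -
  interpret A: subgroup A G by fact
  \<comment> \<open>Restricting to \<open>F\<close> discards the values elsewhere, which places the
    image in a finite product of finite classes.\<close>
  let ?\<phi> = "\<lambda>a. \<lambda>x\<in>F. conj a x"
  have "?\<phi> ` A \<subseteq> (\<Pi>\<^sub>E x\<in>F. (\<lambda>a. conj a x) ` A)"
    by auto
  moreover have "finite \<dots>"
    using F by (intro finite_PiE) auto
  ultimately have "finite (?\<phi> ` A)"
    by (rule finite_subset)
  then obtain b where b: "b \<in> A" and inf: "infinite {a \<in> A. ?\<phi> a = ?\<phi> b}"
    using pigeonhole_infinite[OF A(2)] by blast
  let ?B = "{a \<in> A. ?\<phi> a = ?\<phi> b}"
  have "(\<lambda>a. inv b \<otimes> a) ` ?B \<subseteq> {a \<in> A. \<forall>x\<in>F. conj a x = x}"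
  proof clarsimp
    fix a assume a: "a \<in> A" and eq: "?\<phi> a = ?\<phi> b"
    have "conj (inv b \<otimes> a) x = x" if "x \<in> F" for x
    proof -
      have "x \<in> carrier G" "a \<in> carrier G" "b \<in> carrier G"
        using that F(2) a b by auto
      moreover have "conj a x = conj b x"
        using that fun_cong[OF eq, of x] by simp
      ultimately show ?thesis
        by (simp flip: conj_comp) (simp add: conj_comp, simp add: conj_def)
    qed
    then show "inv b \<otimes> a \<in> A \<and> (\<forall>x\<in>F. conj (inv b \<otimes> a) x = x)"
      using a b by simp
  qed
  moreover have "inj_on (\<lambda>a. inv b \<otimes> a) ?B"
    using b by (auto intro!: inj_onI)
  then have "infinite ((\<lambda>a. inv b \<otimes> a) ` ?B)"
    using inf by (simp add: finite_image_iff)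
  ultimately show ?thesis
    using finite_subset by blast
qed

section \<open>Averaging over a subgroup of finite index\<close>

lemma rcosets_translate:
  assumes "subgroup H G" "g \<in> carrier G"
  shows "bij_betw (\<lambda>C. C #> g) (rcosets H) (rcosets H)"
proof (rule bij_betw_byWitness[where f' = "\<lambda>C. C #> inv g"])
  have H: "H \<subseteq> carrier G"
    using assms(1) by (rule subgroup.subset)
  show "\<forall>C\<in>rcosets H. C #> g #> inv g = C" "\<forall>C\<in>rcosets H. C #> inv g #> g = C"
    using H assms(2) by (auto simp: RCOSETS_def coset_mult_assoc m_assoc)
  show "(\<lambda>C. C #> g) ` (rcosets H) \<subseteq> rcosets H" "(\<lambda>C. C #> inv g) ` (rcosets H) \<subseteq> rcosets H"
    using H assms(2) by (auto simp: RCOSETS_def coset_mult_assoc) (metis inv_closed m_closed)+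
qed

text \<open>Conjugating \<mu> by a representative of a right coset of \<open>H\<close> gives a mean
  that depends on the coset alone. Conjugation by \<open>g\<close> then merely permutes these means,
  so their average is invariant.\<close>

lemma inner_amenable_of_finite_index:
  assumes H: "subgroup H G" "finite (rcosets H)"
    and \<mu>: "mean_on (carrier G) \<mu>" "\<And>x. x \<in> carrier G \<Longrightarrow> \<mu> {x} = 0"
      "\<And>h S. \<lbrakk>h \<in> H; S \<subseteq> carrier G\<rbrakk> \<Longrightarrow> \<mu> (conj h ` S) = \<mu> S"
  shows "inner_amenable G"
proof -
  interpret H: subgroup H G by fact
  define r where "r C = (SOME c. c \<in> C)" for C :: "'a set"
  have r: "r C \<in> C" "r C \<in> carrier G" "C = H #> r C" if C: "C \<in> rcosets H" for C
  proof -
    obtain c where c: "c \<in> carrier G" "C = H #> c"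
      using C by (auto simp: RCOSETS_def)
    then show "r C \<in> C"
      unfolding r_def using rcos_self[OF c(1) H(1)] by (metis someI)
    then show "r C \<in> carrier G" "C = H #> r C"
      using c r_coset_subset_G[OF H.subset c(1)] repr_independence[OF _ c(1) H(1)] by auto
  qed
  define \<nu> where "\<nu> C S = \<mu> (conj (r C) ` S)" for C S
  \<comment> \<open>Two representatives of \<open>C\<close> differ by a left factor in
    \<open>H\<close>, and this factor is absorbed by the \<open>H\<close>-invariance of
    \<mu>.\<close>
  have \<nu>_eq: "\<nu> C S = \<mu> (conj c ` S)" if C: "C \<in> rcosets H" "c \<in> C" "S \<subseteq> carrier G" for C c S
  proof -
    obtain h where h: "h \<in> H" "c = h \<otimes> r C"
      using r(3)[OF C(1)] C(2) by (auto simp: r_coset_def)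
    have "conj c ` S = conj h ` conj (r C) ` S"
      using h r(2)[OF C(1)] C(3) by (simp add: image_conj_comp)
    moreover have "conj (r C) ` S \<subseteq> carrier G"
      using r(2)[OF C(1)] C(3) by auto
    ultimately show ?thesis
      using \<mu>(3) h(1) by (simp add: \<nu>_def)
  qed
  \<comment> \<open>Conjugating first by \<open>g\<close> and then by \<open>r C\<close> is
    conjugating by \<open>r C \<otimes> g\<close>, a representative of the translated coset.\<close>
  have \<nu>_conj: "\<nu> C (conj g ` S) = \<nu> (C #> g) S"
    if C: "C \<in> rcosets H" and g: "g \<in> carrier G" and S: "S \<subseteq> carrier G" for C g S
  proof -
    have "C #> g \<in> rcosets H"
      using rcosets_translate[OF H(1) g] C by (auto simp: bij_betw_def)
    moreover have "r C \<otimes> g \<in> C #> g"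
      using r(1)[OF C] by (auto simp: r_coset_def)
    ultimately show ?thesis
      using \<nu>_eq[of "C #> g" "r C \<otimes> g" S] r(2)[OF C] g S by (simp add: \<nu>_def image_conj_comp)
  qed
  define n where "n = real (card (rcosets H))"
  have "rcosets H \<noteq> {}"
    using rcosetsI[OF H.subset one_closed] by auto
  then have n: "n > 0"
    using H(2) by (simp add: n_def card_gt_0_iff)
  define M where "M S = (\<Sum>C\<in>rcosets H. \<nu> C S) / n" for S
  \<comment> \<open>Conjugation by \<open>r C\<close> is a bijection of the group, so it preserves
    disjointness and the total mass.\<close>
  have \<nu>_mean: "mean_on (carrier G) (\<nu> C)" if C: "C \<in> rcosets H" for C
  proof -
    have c: "r C \<in> carrier G"
      using r(2)[OF C] .
    have sub: "conj (r C) ` S \<subseteq> carrier G" if "S \<subseteq> carrier G" for S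
      using c that by auto
    have "conj (r C) (conj (inv (r C)) x) = x" if "x \<in> carrier G" for x
      using c that by (simp add: conj_comp) (simp add: conj_def)
    then have "conj (r C) ` carrier G = carrier G"
      using c by (auto simp: image_iff) (metis conj_closed inv_closed)
    moreover have "\<nu> C (S \<union> T) = \<nu> C S + \<nu> C T"
      if "S \<subseteq> carrier G" "T \<subseteq> carrier G" "S \<inter> T = {}" for S T
    proof -
      have "conj (r C) ` S \<inter> conj (r C) ` T = {}"
        using inj_on_image_Int[OF inj_on_conj[OF c] that(1,2)] that(3) by simp
      then show ?thesis
        using \<mu>(1) sub that by (simp add: \<nu>_def mean_on_def additive_def image_Un)
    qed
    ultimately show ?thesis
      using \<mu>(1) sub by (auto simp: mean_on_def additive_def \<nu>_def)
  qed
  have "mean_on (carrier G) M"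
    unfolding mean_on_def additive_def
  proof (intro conjI ballI allI impI)
    fix S T assume ST: "S \<in> Pow (carrier G)" "T \<in> Pow (carrier G)" "S \<inter> T = {}"
    then have "\<nu> C (S \<union> T) = \<nu> C S + \<nu> C T" if "C \<in> rcosets H" for C
      using \<nu>_mean[OF that] by (simp add: mean_on_def additive_def)
    then show "M (S \<union> T) = M S + M T"
      by (simp add: M_def sum.distrib add_divide_distrib)
  next
    fix S assume "S \<subseteq> carrier G"
    then show "0 \<le> M S"
      using \<nu>_mean n unfolding M_def mean_on_def by (intro divide_nonneg_pos sum_nonneg) auto
  next
    have "(\<Sum>C\<in>rcosets H. \<nu> C (carrier G)) = n"
      using \<nu>_mean by (simp add: mean_on_def n_def)
    then show "M (carrier G) = 1"
      using n by (simp add: M_def)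
  qed
  moreover have "M {x} = 0" if "x \<in> carrier G" for x
    using that \<mu>(2) r(2) by (simp add: M_def \<nu>_def)
  moreover have "M (conj g ` S) = M S" if "g \<in> carrier G" "S \<subseteq> carrier G" for g S
  proof -
    have "(\<Sum>C\<in>rcosets H. \<nu> C (conj g ` S)) = (\<Sum>C\<in>rcosets H. \<nu> (C #> g) S)"
      using \<nu>_conj that by (intro sum.cong) auto
    \<comment> \<open>Right translation by \<open>g\<close> permutes the cosets, so it only
      reindexes the sum.\<close>
    also have "\<dots> = (\<Sum>C\<in>rcosets H. \<nu> C S)"
      using sum.reindex_bij_betw[OF rcosets_translate[OF H(1) that(1)]] .
    finally show ?thesis
      by (simp add: M_def)
  qed
  ultimately show ?thesis
    unfolding inner_amenable_def conj_def[symmetric] by (intro exI[of _ M]) simp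
qed

text \<open>Elements of \<open>A\<close> that commute with a finite part of \<open>H\<close> serve
  as the common fixed points of conjugation by that part. The resulting mean is
  \<open>H\<close>-invariant, and thinness provides the finite index needed for averaging.\<close>

lemma inner_amenable_of_infinite_thin:
  assumes thin: "thin_on A G (discrete_topology (carrier G))" and inf: "infinite A"
  shows "inner_amenable G"
proof -
  define H where "H = BC_centralizer G (discrete_topology (carrier G)) A"
  have A: "subgroup A G" and fin: "finite (rcosets H)"
    using thin by (auto simp: thin_on_def H_def)
  interpret A: subgroup A G by fact
  have H_eq: "H = {g \<in> carrier G. finite ((\<lambda>a. conj a g) ` A)}"
    unfolding H_def using A.subset by (rule BC_centralizer_discrete)
  have "\<exists>\<mu>. mean_on (carrier G) \<mu> \<and> (\<forall>x\<in>carrier G. \<mu> {x} = 0) \<and>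
      (\<forall>f\<in>conj ` H. \<forall>S\<subseteq>carrier G. \<mu> (f ` S) = \<mu> S)"
  proof (rule atomless_invariant_mean_of_common_fixed_points)
    show "inj_on f (carrier G) \<and> f ` carrier G \<subseteq> carrier G" if "f \<in> conj ` H" for f
      using that by (auto simp: H_eq inj_on_conj)
  next
    fix F E assume F: "finite F" "F \<subseteq> conj ` H" and E: "finite (E :: 'a set)"
    obtain F' where F': "finite F'" "F' \<subseteq> H" "F = conj ` F'"
      using finite_subset_image[OF F] by blast
    have "F' \<subseteq> carrier G" "\<And>x. x \<in> F' \<Longrightarrow> finite ((\<lambda>a. conj a x) ` A)"
      using F'(2) by (auto simp: H_eq)
    then have "infinite {a \<in> A. \<forall>x\<in>F'. conj a x = x}"
      by (rule infinite_centralizer_of_finite_conjugacy[OF A inf F'(1)])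
    \<comment> \<open>An infinite centralizer cannot fit inside \<open>E\<close>; avoiding every
      finite set in this way is what makes the mean atomless.\<close>
    then have "\<not> {a \<in> A. \<forall>x\<in>F'. conj a x = x} \<subseteq> E"
      using finite_subset[OF _ E] by (rule contrapos_nn)
    then obtain a where a: "a \<in> A" "a \<notin> E" "\<And>x. x \<in> F' \<Longrightarrow> conj a x = x"
      by auto
    have "conj x a = a" if "x \<in> F'" for x
    proof -
      have "x \<in> carrier G"
        using that F'(2) by (auto simp: H_eq)
      then show ?thesis
        using a(1) a(3)[OF that] conj_eq_iff_commute[of a x] conj_eq_iff_commute[of x a] by force
    qed
    then show "\<exists>a\<in>carrier G - E. \<forall>f\<in>F. f a = a"
      using a(1,2) F'(3) by (intro bexI[of _ a]) auto
  qed
  then obtain \<mu> where "mean_on (carrier G) \<mu>" "\<And>x. x \<in> carrier G \<Longrightarrow> \<mu> {x} = 0"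
      "\<And>h S. \<lbrakk>h \<in> H; S \<subseteq> carrier G\<rbrakk> \<Longrightarrow> \<mu> (conj h ` S) = \<mu> S"
    by blast
  moreover have "subgroup H G"
    unfolding H_def using A.subset by (rule subgroup_BC_centralizer_discrete)
  ultimately show ?thesis
    using fin by (intro inner_amenable_of_finite_index)
qed

end

section \<open>Positive rank forces infinite carriers\<close>

text \<open>The integer multiples of a single basis element are pairwise distinct.\<close>

lemma infinite_carrier_free_Abelian_group:
  assumes "S \<noteq> {}"
  shows "infinite (carrier (free_Abelian_group S))"
proof -
  obtain s where s: "s \<in> S"
    using assms by blast
  have "inj (\<lambda>n::int. Poly_Mapping.single s n)"
    by (metis injI lookup_single_eq)
  then have "infinite (range (\<lambda>n::int. Poly_Mapping.single s n))"
    by (simp add: finite_image_iff infinite_UNIV_int)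
  moreover have "range (\<lambda>n::int. Poly_Mapping.single s n) \<subseteq> carrier (free_Abelian_group S)"
    using s by auto
  ultimately show ?thesis
    using finite_subset by blast
qed

text \<open>A positive supremum is witnessed by one free abelian subgroup with nonempty basis, and
  an isomorphism preserves cardinality.\<close>

lemma infinite_carrier_of_free_abelian_rank_sup_pos:
  assumes "free_abelian_rank_sup Q > 0"
  shows "infinite (carrier Q)"
proof -
  obtain z where z: "z > 0" "z \<in> {if finite S then enat (card S) else \<infinity> | (S :: 'a set) B.
      subgroup B Q \<and> Q\<lparr>carrier := B\<rparr> \<cong> free_Abelian_group S}"
    using assms unfolding free_abelian_rank_sup_def less_Sup_iff by (elim bexE)
  then obtain S :: "'a set" and B where S: "(if finite S then enat (card S) else \<infinity>) > 0"
    and B: "subgroup B Q" "Q\<lparr>carrier := B\<rparr> \<cong> free_Abelian_group S"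
    by blast
  have "S \<noteq> {}"
    using S by (auto simp: zero_enat_def)
  then have "infinite (carrier (free_Abelian_group S))"
    by (rule infinite_carrier_free_Abelian_group)
  moreover have "B \<approx> carrier (free_Abelian_group S)"
    using iso_imp_eqpoll_carrier[OF B(2)] by simp
  ultimately have "infinite B"
    by (simp add: eqpoll_finite_iff)
  then show ?thesis
    using subgroup.subset[OF B(1)] finite_subset by blast
qed

text \<open>By contraposition: the cosets forming the quotient are indexed by the elements of
  \<open>A\<close>, so a finite \<open>A\<close> has a finite quotient, which admits no positive
  rank.\<close>

lemma infinite_carrier_of_thin_rank_pos:
  assumes "thin_rank A T > 0"
  shows "infinite (carrier A)"
proof
  assume "finite (carrier A)"
  then have "finite (carrier (A Mod Rad_RC A T))"
    by (simp add: FactGroup_def RCOSETS_def)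
  then show False
    using infinite_carrier_of_free_abelian_rank_sup_pos assms unfolding thin_rank_def by blast
qed

theorem proposition4p6:
  fixes \<Gamma> :: "('a, 'b) monoid_scheme"
  assumes "group \<Gamma>"
    and "rk_BC \<Gamma> (discrete_topology (carrier \<Gamma>)) > 0"
  shows "inner_amenable \<Gamma>"
proof -
  obtain A where "thin_on A \<Gamma> (discrete_topology (carrier \<Gamma>))"
    and "thin_rank (\<Gamma>\<lparr>carrier := A\<rparr>) (subtopology (discrete_topology (carrier \<Gamma>)) A) > 0"
    using assms(2) unfolding rk_BC_def less_Sup_iff by blast
  then show ?thesis
    using group.inner_amenable_of_infinite_thin[OF assms(1), of A]
      infinite_carrier_of_thin_rank_pos[of "\<Gamma>\<lparr>carrier := A\<rparr>"] by simp
qed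

end
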